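(* Any three-dimensional symmetric Walker metric $$g=2\,dt\,dy+\varepsilon\,dx^2+f(x,y)\,dy^2,\qquad f(x,y)=\kappa x^2+xP(y)+Q(y),$$ with $\varepsilon=\pm1$, $\kappa\in\mathbb{R}$ and $P,Q$ smooth functions, is a Ricci soliton, which can be expanding, steady or shrinking, and is defined by the vector fields $$X(t,x,y)=\left(\lambda t-\varepsilon x\,w'(y)+\mu(y),\ \tfrac12\lambda x+w(y),\ \gamma\right)$$ (components with respect to $\partial_t,\partial_x,\partial_y$), where $\lambda$ and $\gamma$ are real constants and the functions $w(y)$ and $\mu(y)$ are arbitrary solutions of the system $$\left\{\begin{array}{l}2\varepsilon w''(y)-2\kappa w(y)=\gamma P'(y)-\frac12\lambda P(y),\\[2pt] 2\mu'(y)=\frac{\kappa}{\varepsilon}-P(y)w(y)+\lambda Q(y)-\gamma Q'(y).\end{array}\right.$$ In general, the causal character of $X$ may vary with the point.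
   Context: A three-dimensional Lorentzian Walker manifold is one admitting a parallel null vector field $\mathcal U$; in adapted coordinates $(t,x,y)$ with $\mathcal U=\partial_t$ its metric has the form $g=2\,dt\,dy+\varepsilon\,dx^2+f(x,y)\,dy^2$, $\varepsilon=\pm1$. Locally symmetric Walker metrics are characterized by $f(x,y)=\kappa x^2+xP(y)+Q(y)$ with $\kappa$ constant ($\kappa=0$ exactly in the flat case); the statement refers to the coordinate domain, with $y$ ranging over an open interval on which $P,Q$ are smooth. $(M,g)$ is a Ricci soliton, defined by the smooth vector field $X$, if $\mathcal{L}_Xg+Ric=\lambda g$ for some constant $\lambda\in\mathbb{R}$, where $\mathcal L_X$ is the Lie derivative and $Ric$ is the Ricci tensor (sign convention: positive on round spheres). In the claim, the $\lambda$ appearing in $X$ is this constant. The soliton is shrinking, steady or expanding according to $\lambda>0$, $\lambda=0$, $\lambda<0$. The causal character of $X$ at a point is spacelike, timelike or null according to the sign of $g(X,X)$ there. *)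

theory Defs
  imports "HOL-Analysis.Analysis"
begin

text \<open>
  \<open>C\<^sup>k\<close> and smooth real functions on an open set. The continuity required at level 0
  applies to the partial derivatives of order \<open>k\<close>.
\<close>

fun Ck_on :: "nat \<Rightarrow> 'a::euclidean_space set \<Rightarrow> ('a \<Rightarrow> real) \<Rightarrow> bool" where
  "Ck_on 0 U h \<longleftrightarrow> continuous_on U h"
| "Ck_on (Suc k) U h \<longleftrightarrow>
     (\<forall>p\<in>U. h differentiable (at p)) \<and>
     (\<forall>b\<in>Basis. Ck_on k U (\<lambda>p. frechet_derivative h (at p) b))"

definition smooth_on :: "'a::euclidean_space set \<Rightarrow> ('a \<Rightarrow> real) \<Rightarrow> bool" where
  "smooth_on U h \<longleftrightarrow> (\<forall>k. Ck_on k U h)"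

text \<open>
  Tensor calculus on an open subset of \<open>\<real>\<^sup>n\<close> in the standard coordinates: a metric is the
  field of its Gram matrices, a vector field is the field of its component vectors.
\<close>

definition partial :: "'n \<Rightarrow> (real^'n \<Rightarrow> real) \<Rightarrow> real^'n \<Rightarrow> real" where
  "partial i h p = frechet_derivative h (at p) (axis i 1)"

definition pseudo_riemannian_on :: "(real^'n) set \<Rightarrow> (real^'n \<Rightarrow> real^'n^'n) \<Rightarrow> bool" where
  "pseudo_riemannian_on U g \<longleftrightarrow>
     (\<forall>i j. smooth_on U (\<lambda>p. g p $ i $ j)) \<and>
     (\<forall>p\<in>U. transpose (g p) = g p \<and> invertible (g p))"

text \<open>\<open>christoffel g k i j\<close> is \<open>\<Gamma>\<^sup>k\<^sub>i\<^sub>j\<close>.\<close>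

definition christoffel ::
    "(real^'n \<Rightarrow> real^'n^'n) \<Rightarrow> 'n \<Rightarrow> 'n \<Rightarrow> 'n \<Rightarrow> real^'n \<Rightarrow> real" where
  "christoffel g k i j p =
     (\<Sum>l\<in>UNIV. matrix_inv (g p) $ k $ l *
        (partial i (\<lambda>q. g q $ j $ l) p + partial j (\<lambda>q. g q $ i $ l) p
          - partial l (\<lambda>q. g q $ i $ j) p)) / 2"

text \<open>
  \<open>riemann g l k i j\<close> is the \<open>\<partial>\<^sub>l\<close>-component of \<open>R(\<partial>\<^sub>i, \<partial>\<^sub>j)\<partial>\<^sub>k\<close>, where
  \<open>R(V, W) = \<nabla>\<^sub>V\<nabla>\<^sub>W - \<nabla>\<^sub>W\<nabla>\<^sub>V - \<nabla>\<^bsub>[V,W]\<^esub>\<close>. The Ricci tensor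
  \<open>Ric(Y, Z) = tr (V \<mapsto> R(V, Y) Z)\<close> is then positive on round spheres.
\<close>

definition riemann ::
    "(real^'n \<Rightarrow> real^'n^'n) \<Rightarrow> 'n \<Rightarrow> 'n \<Rightarrow> 'n \<Rightarrow> 'n \<Rightarrow> real^'n \<Rightarrow> real" where
  "riemann g l k i j p =
     partial i (christoffel g l j k) p - partial j (christoffel g l i k) p
     + (\<Sum>m\<in>UNIV. christoffel g l i m p * christoffel g m j k p
                 - christoffel g l j m p * christoffel g m i k p)"

definition ricci :: "(real^'n \<Rightarrow> real^'n^'n) \<Rightarrow> 'n \<Rightarrow> 'n \<Rightarrow> real^'n \<Rightarrow> real" where
  "ricci g j k p = (\<Sum>i\<in>UNIV. riemann g i k i j p)"

definition lie_derivative_metric ::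
    "(real^'n \<Rightarrow> real^'n) \<Rightarrow> (real^'n \<Rightarrow> real^'n^'n) \<Rightarrow> 'n \<Rightarrow> 'n \<Rightarrow> real^'n \<Rightarrow> real" where
  "lie_derivative_metric X g i j p =
     (\<Sum>k\<in>UNIV. X p $ k * partial k (\<lambda>q. g q $ i $ j) p
        + g p $ k $ j * partial i (\<lambda>q. X q $ k) p
        + g p $ i $ k * partial j (\<lambda>q. X q $ k) p)"

definition ricci_soliton_on ::
    "(real^'n) set \<Rightarrow> (real^'n \<Rightarrow> real^'n^'n) \<Rightarrow> (real^'n \<Rightarrow> real^'n) \<Rightarrow> real \<Rightarrow> bool" where
  "ricci_soliton_on U g X lam \<longleftrightarrow>
     pseudo_riemannian_on U g \<and>
     (\<forall>i. smooth_on U (\<lambda>p. X p $ i)) \<and>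
     (\<forall>p\<in>U. \<forall>i j. lie_derivative_metric X g i j p + ricci g i j p = lam * g p $ i $ j)"

definition shrinking_soliton_on ::
    "(real^'n) set \<Rightarrow> (real^'n \<Rightarrow> real^'n^'n) \<Rightarrow> (real^'n \<Rightarrow> real^'n) \<Rightarrow> bool" where
  "shrinking_soliton_on U g X \<longleftrightarrow> (\<exists>lam>0. ricci_soliton_on U g X lam)"

definition steady_soliton_on ::
    "(real^'n) set \<Rightarrow> (real^'n \<Rightarrow> real^'n^'n) \<Rightarrow> (real^'n \<Rightarrow> real^'n) \<Rightarrow> bool" where
  "steady_soliton_on U g X \<longleftrightarrow> ricci_soliton_on U g X 0"

definition expanding_soliton_on ::
    "(real^'n) set \<Rightarrow> (real^'n \<Rightarrow> real^'n^'n) \<Rightarrow> (real^'n \<Rightarrow> real^'n) \<Rightarrow> bool" where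
  "expanding_soliton_on U g X \<longleftrightarrow> (\<exists>lam<0. ricci_soliton_on U g X lam)"

datatype causal_character = Spacelike | Timelike | Null

definition causal_character_at ::
    "(real^'n \<Rightarrow> real^'n^'n) \<Rightarrow> (real^'n \<Rightarrow> real^'n) \<Rightarrow> real^'n \<Rightarrow> causal_character" where
  "causal_character_at g X p =
     (let s = X p \<bullet> (g p *v X p)
      in if s > 0 then Spacelike else if s < 0 then Timelike else Null)"

text \<open>
  Walker metrics in coordinates \<open>(t, x, y) = (p $ 1, p $ 2, p $ 3)\<close>:
  \<open>2 dt dy + \<epsilon> dx\<^sup>2 + f(x, y) dy\<^sup>2\<close>.
\<close>

definition walker_metric :: "real \<Rightarrow> (real \<Rightarrow> real \<Rightarrow> real) \<Rightarrow> real^3 \<Rightarrow> real^3^3" where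
  "walker_metric eps f p =
     vector [vector [0, 0, 1], vector [0, eps, 0], vector [1, 0, f (p $ 2) (p $ 3)]]"

definition symmetric_walker_metric ::
    "real \<Rightarrow> real \<Rightarrow> (real \<Rightarrow> real) \<Rightarrow> (real \<Rightarrow> real) \<Rightarrow> real^3 \<Rightarrow> real^3^3" where
  "symmetric_walker_metric eps kap P Q =
     walker_metric eps (\<lambda>x y. kap * x\<^sup>2 + x * P y + Q y)"

definition walker_chart :: "real set \<Rightarrow> (real^3) set" where
  "walker_chart I = {p. p $ 3 \<in> I}"

text \<open>
  Classical solutions on \<open>I\<close>: differentiability of \<open>w\<close>, \<open>w'\<close>, \<open>\<mu>\<close> is demanded explicitly
  because \<open>deriv\<close> is total.
\<close>

definition soliton_system ::
    "real set \<Rightarrow> real \<Rightarrow> real \<Rightarrow> (real \<Rightarrow> real) \<Rightarrow> (real \<Rightarrow> real) \<Rightarrow> real \<Rightarrow> real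
      \<Rightarrow> (real \<Rightarrow> real) \<Rightarrow> (real \<Rightarrow> real) \<Rightarrow> bool" where
  "soliton_system I eps kap P Q lam gam w mu \<longleftrightarrow>
     (\<forall>y\<in>I. w field_differentiable at y \<and> deriv w field_differentiable at y \<and>
        mu field_differentiable at y \<and>
        2 * eps * deriv (deriv w) y - 2 * kap * w y = gam * deriv P y - lam * P y / 2 \<and>
        2 * deriv mu y = kap / eps - P y * w y + lam * Q y - gam * deriv Q y)"

definition walker_soliton_field ::
    "real \<Rightarrow> real \<Rightarrow> real \<Rightarrow> (real \<Rightarrow> real) \<Rightarrow> (real \<Rightarrow> real) \<Rightarrow> real^3 \<Rightarrow> real^3" where
  "walker_soliton_field eps lam gam w mu p =
     vector [lam * p $ 1 - eps * p $ 2 * deriv w (p $ 3) + mu (p $ 3),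
             lam * p $ 2 / 2 + w (p $ 3),
             gam]"

end

theory Submission
  imports Defs
begin

text \<open>
  The only nonzero Christoffel symbols are \<open>\<Gamma>\<^sup>t\<^sub>x\<^sub>y = f\<^sub>x / 2\<close>, \<open>\<Gamma>\<^sup>t\<^sub>y\<^sub>y = f\<^sub>y / 2\<close> and
  \<open>\<Gamma>\<^sup>x\<^sub>y\<^sub>y = - f\<^sub>x / (2 \<epsilon>)\<close>, so the only Ricci component is \<open>Ric\<^sub>y\<^sub>y = - \<kappa> / \<epsilon>\<close>. All components of
  the soliton equation except \<open>yy\<close> hold identically for the given \<open>X\<close>, while the \<open>yy\<close> component is
  affine in \<open>x\<close> (the \<open>x\<^sup>2\<close> terms cancel) and its two coefficients are the two equations of the system.
  The system is solvable on the whole interval because it is linear with constant leading part: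
  variation of parameters gives \<open>w\<close>, one more integration gives \<open>\<mu>\<close>. Finally \<open>g(X, X)\<close> is affine in
  \<open>t\<close> with slope \<open>2 \<lambda> \<gamma>\<close> along \<open>x = 0\<close>, \<open>y\<close> constant, so its sign varies whenever \<open>\<lambda> \<gamma> \<noteq> 0\<close>.
\<close>


section \<open>Calculus of functions of class C^k on open sets\<close>

lemma frechet_derivative_has_derivative:
  "(h has_derivative h') (at p) \<Longrightarrow> frechet_derivative h (at p) = h'"
  by (metis frechet_derivative_at)

lemma frechet_derivative_cong_open:
  fixes f g :: "'a::euclidean_space \<Rightarrow> real"
  assumes "open U" "p \<in> U" "\<And>q. q \<in> U \<Longrightarrow> f q = g q" "f differentiable (at p)"
  shows "g differentiable (at p)" "frechet_derivative g (at p) = frechet_derivative f (at p)"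
proof -
  have "(f has_derivative frechet_derivative f (at p)) (at p)"
    using assms(4) by (simp add: frechet_derivative_works)
  then have "(g has_derivative frechet_derivative f (at p)) (at p)"
    by (rule has_derivative_transform_within_open[OF _ assms(1,2,3)])
  then show "g differentiable (at p)" "frechet_derivative g (at p) = frechet_derivative f (at p)"
    by (auto simp: differentiable_def frechet_derivative_has_derivative)
qed

text \<open>On an open set the derivative at a point depends only on nearby values, so agreement on
  \<open>U\<close> passes to the partial derivatives, again only on \<open>U\<close>; hence the
  induction generalizes over both functions.\<close>

lemma Ck_on_cong:
  assumes "open U" "\<And>p. p \<in> U \<Longrightarrow> f p = g p" "Ck_on k U f"
  shows "Ck_on k U g"
  using assms(2,3)
proof (induction k arbitrary: f g)
  case 0
  then show ?case by (simp cong: continuous_on_cong)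
next
  case (Suc k)
  have d: "f differentiable (at p)" if "p \<in> U" for p
    using Suc.prems that by simp
  note c = frechet_derivative_cong_open[OF assms(1) _ Suc.prems(1) d]
  show ?case
    unfolding Ck_on.simps
  proof (intro conjI ballI)
    fix b :: 'a assume b: "b \<in> Basis"
    show "Ck_on k U (\<lambda>p. frechet_derivative g (at p) b)"
      by (rule Suc.IH[of "\<lambda>p. frechet_derivative f (at p) b"]) (use Suc.prems b c in auto)
  qed (use c in auto)
qed

text \<open>Lets an explicit derivative stand in for \<open>frechet_derivative\<close> when raising
  the order by one.\<close>

lemma Ck_on_Suc_I:
  assumes "open U" "\<And>p. p \<in> U \<Longrightarrow> (f has_derivative f' p) (at p)"
    "\<And>b. b \<in> Basis \<Longrightarrow> Ck_on k U (\<lambda>p. f' p b)"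
  shows "Ck_on (Suc k) U f"
  unfolding Ck_on.simps
proof (intro conjI ballI)
  fix b :: 'a assume b: "b \<in> Basis"
  show "Ck_on k U (\<lambda>p. frechet_derivative f (at p) b)"
    by (rule Ck_on_cong[OF assms(1) _ assms(3)[OF b]])
      (simp add: frechet_derivative_has_derivative[OF assms(2)])
qed (use assms(2) in \<open>auto simp: differentiable_def\<close>)

lemma Ck_on_Suc_D: "Ck_on (Suc k) U f \<Longrightarrow> Ck_on k U f"
proof (induction k arbitrary: f)
  case 0
  then show ?case
    using differentiable_imp_continuous_on[OF differentiable_at_imp_differentiable_on, of U f]
    by simp
next
  case (Suc k)
  then show ?case by simp
qed

lemma Ck_on_const: "open U \<Longrightarrow> Ck_on k U (\<lambda>p. c)"
proof (induction k arbitrary: c)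
  case (Suc k)
  then show ?case by (intro Ck_on_Suc_I[where f' = "\<lambda>p h. 0"]) auto
qed simp

lemma Ck_on_linear:
  fixes f :: "'a::euclidean_space \<Rightarrow> real"
  assumes "open U" "bounded_linear f"
  shows "Ck_on k U f"
proof (cases k)
  case 0
  then show ?thesis
    using assms(2) by (simp add: linear_continuous_on)
next
  case (Suc m)
  show ?thesis unfolding Suc
    by (rule Ck_on_Suc_I[where f' = "\<lambda>p. f"])
      (use assms in \<open>auto intro: Ck_on_const bounded_linear_imp_has_derivative\<close>)
qed

lemma Ck_on_works:
  assumes "Ck_on (Suc k) U f" "p \<in> U"
  shows "(f has_derivative frechet_derivative f (at p)) (at p)"
  using assms by (simp add: frechet_derivative_works)

lemma Ck_on_add:
  assumes "open U" "Ck_on k U f" "Ck_on k U g"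
  shows "Ck_on k U (\<lambda>p. f p + g p)"
  using assms(2,3)
proof (induction k arbitrary: f g)
  case 0
  then show ?case by (simp add: continuous_on_add)
next
  case (Suc k)
  show ?case
    by (rule Ck_on_Suc_I[OF assms(1) has_derivative_add[OF Suc.prems[THEN Ck_on_works]]])
      (use Suc in auto)
qed

text \<open>Induction by the Leibniz rule. Each term of the derivative keeps one factor
  undifferentiated; \<open>Ck_on_Suc_D\<close> lowers its order to the one that the induction
  hypothesis takes.\<close>

lemma Ck_on_mult:
  assumes "open U" "Ck_on k U f" "Ck_on k U g"
  shows "Ck_on k U (\<lambda>p. f p * g p)"
  using assms(2,3)
proof (induction k arbitrary: f g)
  case 0
  then show ?case by (simp add: continuous_on_mult)
next
  case (Suc k)
  show ?case
    by (rule Ck_on_Suc_I[OF assms(1) has_derivative_mult[OF Suc.prems[THEN Ck_on_works]]])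
      (use Suc Suc.prems[THEN Ck_on_Suc_D] in \<open>auto intro!: Ck_on_add[OF assms(1)]\<close>)
qed

lemma smooth_on_cong:
  "open U \<Longrightarrow> (\<And>p. p \<in> U \<Longrightarrow> f p = g p) \<Longrightarrow> smooth_on U f \<Longrightarrow> smooth_on U g"
  unfolding smooth_on_def by (blast intro: Ck_on_cong)

lemma smooth_on_const: "open U \<Longrightarrow> smooth_on U (\<lambda>p. c)"
  by (simp add: smooth_on_def Ck_on_const)

lemma smooth_on_linear: "open U \<Longrightarrow> bounded_linear f \<Longrightarrow> smooth_on U f"
  by (simp add: smooth_on_def Ck_on_linear)

lemma smooth_on_add:
  "open U \<Longrightarrow> smooth_on U f \<Longrightarrow> smooth_on U g \<Longrightarrow> smooth_on U (\<lambda>p. f p + g p)"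
  by (simp add: smooth_on_def Ck_on_add)

lemma smooth_on_mult:
  "open U \<Longrightarrow> smooth_on U f \<Longrightarrow> smooth_on U g \<Longrightarrow> smooth_on U (\<lambda>p. f p * g p)"
  by (simp add: smooth_on_def Ck_on_mult)

lemma smooth_on_diff:
  assumes "open U" "smooth_on U f" "smooth_on U g"
  shows "smooth_on U (\<lambda>p. f p - g p)"
  using smooth_on_add[OF assms(1,2) smooth_on_mult[OF assms(1) smooth_on_const[OF assms(1), of "-1"] assms(3)]]
  by simp

section \<open>Smooth functions of one real variable and their composition with a coordinate\<close>

lemma frechet_derivative_real:
  fixes f :: "real \<Rightarrow> real"
  assumes "f field_differentiable at y"
  shows "frechet_derivative f (at y) = (\<lambda>h. deriv f y * h)"
  using assms DERIV_deriv_iff_field_differentiable[of f y]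
  by (auto simp: has_field_derivative_def intro!: frechet_derivative_has_derivative)

lemma differentiable_real_iff:
  fixes f :: "real \<Rightarrow> real"
  shows "f differentiable at y \<longleftrightarrow> f field_differentiable at y"
  by (simp add: field_differentiable_def real_differentiable_def)

text \<open>The only basis vector of the real line is 1, and the derivative in that direction is
  \<open>deriv f\<close>.\<close>

lemma Ck_on_real_Suc:
  fixes f :: "real \<Rightarrow> real"
  assumes "open I"
  shows "Ck_on (Suc k) I f \<longleftrightarrow> (\<forall>y\<in>I. f field_differentiable at y) \<and> Ck_on k I (deriv f)"
proof -
  have "Ck_on k I (\<lambda>p. frechet_derivative f (at p) 1) \<longleftrightarrow> Ck_on k I (deriv f)"
    if "\<forall>y\<in>I. f field_differentiable at y"
    using that by (intro iffI; elim Ck_on_cong[OF assms, rotated]) (auto simp: frechet_derivative_real)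
  then show ?thesis by (auto simp: differentiable_real_iff)
qed

lemma smooth_on_deriv_iff:
  fixes f :: "real \<Rightarrow> real"
  assumes "open I"
  shows "smooth_on I f \<longleftrightarrow> (\<forall>y\<in>I. f field_differentiable at y) \<and> smooth_on I (deriv f)"
  using Ck_on_real_Suc[OF assms, of _ f] Ck_on_Suc_D[of _ I f]
  unfolding smooth_on_def by (metis)

lemma has_derivative_coordinate:
  fixes p :: "real^'n"
  assumes "h field_differentiable at (p $ i)"
  shows "((\<lambda>q. h (q $ i)) has_derivative (\<lambda>v. deriv h (p $ i) * v $ i)) (at p)"
  using assms
  by (intro has_derivative_compose[of "\<lambda>p. p $ i" "\<lambda>h. h $ i" p UNIV h "\<lambda>v. deriv h (p $ i) * v"])
    (auto simp: DERIV_deriv_iff_field_differentiable[symmetric] has_field_derivative_def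
      intro!: bounded_linear_imp_has_derivative bounded_linear_vec_nth)

text \<open>By the chain rule the derivative in direction \<open>b\<close> is
  \<open>deriv f (p $ i)\<close> times the constant \<open>b $ i\<close>. It has the same form with
  \<open>deriv f\<close> for \<open>f\<close>, so the induction closes.\<close>

lemma Ck_on_coordinate:
  fixes f :: "real \<Rightarrow> real"
  assumes "open I" "open U" "\<And>p. p \<in> U \<Longrightarrow> p $ i \<in> I" "Ck_on k I f"
  shows "Ck_on k (U :: (real^'n) set) (\<lambda>p. f (p $ i))"
  using assms(4)
proof (induction k arbitrary: f)
  case 0
  then show ?case
    by (auto intro!: continuous_on_compose2[of I f] continuous_intros assms(3))
next
  case (Suc k)
  then have f: "f field_differentiable at y" if "y \<in> I" for y
    using that by (simp add: Ck_on_real_Suc[OF assms(1)] del: Ck_on.simps)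
  show ?case
    by (rule Ck_on_Suc_I[OF assms(2) has_derivative_coordinate[OF f[OF assms(3)]]])
      (use Suc in \<open>auto intro!: Ck_on_mult[OF assms(2)] Ck_on_const[OF assms(2)]
        simp: Ck_on_real_Suc[OF assms(1)] simp del: Ck_on.simps\<close>)
qed

lemma smooth_on_coordinate:
  "open I \<Longrightarrow> open U \<Longrightarrow> (\<And>p. p \<in> U \<Longrightarrow> p $ i \<in> I) \<Longrightarrow> smooth_on I f
    \<Longrightarrow> smooth_on (U :: (real^'n) set) (\<lambda>p. f (p $ i))"
  unfolding smooth_on_def by (blast intro: Ck_on_coordinate)


section \<open>The Walker metric in coordinates: inverse, smoothness, nondegeneracy\<close>

text \<open>For square matrices a right inverse is also a left inverse, and inverses are unique;
  this pins down the choice made in \<open>matrix_inv\<close>.\<close>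

lemma matrix_inv_eqI:
  fixes A B :: "real^'n^'n"
  assumes "A ** B = mat 1"
  shows "matrix_inv A = B"
proof -
  have BA: "B ** A = mat 1"
    using assms matrix_left_right_inverse by blast
  then have "\<exists>B. A ** B = mat 1 \<and> B ** A = mat 1"
    using assms by blast
  then have "A ** matrix_inv A = mat 1"
    unfolding matrix_inv_def by (rule someI2_ex) blast
  then show ?thesis
    by (metis BA matrix_mul_assoc matrix_mul_lid matrix_mul_rid)
qed

lemma partial_eq: "(h has_derivative h') (at p) \<Longrightarrow> partial i h p = h' (axis i 1)"
  by (simp add: partial_def frechet_derivative_has_derivative)

lemma partial_cong_open:
  assumes "open U" "p \<in> U" "\<And>q. q \<in> U \<Longrightarrow> f q = g q" "f differentiable (at p)"
  shows "partial i g p = partial i f p"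
  by (simp add: partial_def frechet_derivative_cong_open[OF assms])

lemma has_derivative_vec_nth: "((\<lambda>q. q $ i) has_derivative (\<lambda>v. v $ i)) (at (p :: real^'n))"
  by (intro bounded_linear_imp_has_derivative bounded_linear_vec_nth)

lemma walker_metric_components:
  "walker_metric eps f p $ 1 $ 1 = 0" "walker_metric eps f p $ 1 $ 2 = 0"
  "walker_metric eps f p $ 1 $ 3 = 1" "walker_metric eps f p $ 2 $ 1 = 0"
  "walker_metric eps f p $ 2 $ 2 = eps" "walker_metric eps f p $ 2 $ 3 = 0"
  "walker_metric eps f p $ 3 $ 1 = 1" "walker_metric eps f p $ 3 $ 2 = 0"
  "walker_metric eps f p $ 3 $ 3 = f (p $ 2) (p $ 3)"
  by (simp_all add: walker_metric_def)

lemmas symmetric_walker_components =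
  walker_metric_components[where f = "\<lambda>x y. kap * x\<^sup>2 + x * P y + Q y",
    folded symmetric_walker_metric_def] for kap P Q

lemma walker_metric_mult_inverse:
  assumes "eps \<noteq> 0"
  shows "walker_metric eps f p **
    vector [vector [- f (p $ 2) (p $ 3), 0, 1], vector [0, 1 / eps, 0], vector [1, 0, 0]] = mat 1"
  using assms
  by (simp add: vec_eq_iff forall_3 matrix_matrix_mult_def mat_def sum_3 walker_metric_components)

lemmas matrix_inv_symmetric_walker =
  matrix_inv_eqI[OF walker_metric_mult_inverse[where f = "\<lambda>x y. kap * x\<^sup>2 + x * P y + Q y"],
    folded symmetric_walker_metric_def] for kap P Q

lemma open_walker_chart: "open I \<Longrightarrow> open (walker_chart I)"
  using open_vimage_vec_nth[of I "3::3"] by (simp add: walker_chart_def vimage_def)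

lemma smooth_on_chart_functions:
  assumes "open I"
  shows "smooth_on (walker_chart I) (\<lambda>p. p $ i)"
    and "smooth_on I h \<Longrightarrow> smooth_on (walker_chart I) (\<lambda>p. h (p $ 3))"
proof -
  note U = open_walker_chart[OF assms]
  show "smooth_on (walker_chart I) (\<lambda>p. p $ i)"
    by (rule smooth_on_linear[OF U bounded_linear_vec_nth])
  show "smooth_on (walker_chart I) (\<lambda>p. h (p $ 3))" if "smooth_on I h"
    by (rule smooth_on_coordinate[OF assms U _ that]) (simp add: walker_chart_def)
qed

lemma pseudo_riemannian_symmetric_walker:
  assumes "open I" "eps \<noteq> 0" "smooth_on I P" "smooth_on I Q"
  shows "pseudo_riemannian_on (walker_chart I) (symmetric_walker_metric eps kap P Q)"
proof -
  note U = open_walker_chart[OF assms(1)] and c = smooth_on_chart_functions[OF assms(1)]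
  have f: "smooth_on (walker_chart I) (\<lambda>p. kap * (p $ 2)\<^sup>2 + p $ 2 * P (p $ 3) + Q (p $ 3))"
    unfolding power2_eq_square
    by (rule smooth_on_const[OF U] smooth_on_add[OF U] smooth_on_mult[OF U] c assms(3,4))+
  have "smooth_on (walker_chart I) (\<lambda>p. symmetric_walker_metric eps kap P Q p $ i $ j)" for i j
    using exhaust_3[of i] exhaust_3[of j] f smooth_on_const[OF U]
    by (elim disjE) (simp_all only: symmetric_walker_components)
  moreover have "transpose (walker_metric eps f p) = walker_metric eps f p" for f p
    by (simp add: vec_eq_iff forall_3 transpose_def walker_metric_components)
  moreover have "invertible (walker_metric eps f p)" for f p
    using walker_metric_mult_inverse[OF assms(2)] invertible_right_inverse by blast
  ultimately show ?thesis
    by (simp add: pseudo_riemannian_on_def symmetric_walker_metric_def)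
qed

section \<open>Christoffel symbols and Ricci tensor of the symmetric Walker metric\<close>

lemma axis_components: "axis i (1::real) $ j = (if i = j then 1 else 0)"
  by (simp add: axis_def)

lemma partial_symmetric_walker:
  assumes "P field_differentiable at (p $ 3)" "Q field_differentiable at (p $ 3)"
  shows "partial i (\<lambda>q. symmetric_walker_metric eps kap P Q q $ j $ l) p =
    (if j = 3 \<and> l = 3 then
       (if i = 2 then 2 * kap * p $ 2 + P (p $ 3)
        else if i = 3 then p $ 2 * deriv P (p $ 3) + deriv Q (p $ 3) else 0)
     else 0)"
proof -
  have "partial i (\<lambda>q. kap * (q $ 2)\<^sup>2 + q $ 2 * P (q $ 3) + Q (q $ 3)) p =
    (if i = 2 then 2 * kap * p $ 2 + P (p $ 3)
     else if i = 3 then p $ 2 * deriv P (p $ 3) + deriv Q (p $ 3) else 0)"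
    using exhaust_3[of i] partial_eq[OF has_derivative_add[OF has_derivative_add[OF
      has_derivative_mult_right[OF has_derivative_power[OF has_derivative_vec_nth]]
      has_derivative_mult[OF has_derivative_vec_nth has_derivative_coordinate[OF assms(1)]]]
      has_derivative_coordinate[OF assms(2)]], of i kap 2 2 2]
    by (auto simp: axis_components)
  moreover have "partial i (\<lambda>q. c) p = 0" for c
    by (simp add: partial_eq[OF has_derivative_const])
  ultimately show ?thesis
    using exhaust_3[of j] exhaust_3[of l] by (auto simp: symmetric_walker_components)
qed

text \<open>The entry \<open>-f\<close> of the inverse metric never contributes: it multiplies
  derivatives of the constant first row of the metric and a derivative in \<open>t\<close>, all
  zero. Hence the symbols are linear in the first derivatives of \<open>f\<close>.\<close>

lemma christoffel_symmetric_walker: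
  assumes "eps \<noteq> 0" "P field_differentiable at (p $ 3)" "Q field_differentiable at (p $ 3)"
  shows "christoffel (symmetric_walker_metric eps kap P Q) k i j p =
    (if k = 1 \<and> (i = 2 \<and> j = 3 \<or> i = 3 \<and> j = 2) then kap * p $ 2 + P (p $ 3) / 2
     else if k = 1 \<and> i = 3 \<and> j = 3 then (p $ 2 * deriv P (p $ 3) + deriv Q (p $ 3)) / 2
     else if k = 2 \<and> i = 3 \<and> j = 3 then - (2 * kap * p $ 2 + P (p $ 3)) / (2 * eps)
     else 0)"
  using exhaust_3[of k] exhaust_3[of i] exhaust_3[of j]
  by (elim disjE) (simp_all add: christoffel_def sum_3 partial_symmetric_walker[OF assms(2,3)]
      matrix_inv_symmetric_walker[OF assms(1)] add_divide_distrib)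

text \<open>No nonzero Christoffel symbol has upper index 3 or a lower index 1, and those with upper
  index 2 have both lower indices 3. Therefore all quadratic terms vanish in the Ricci trace, and
  what survives is the \<open>x\<close>-derivative of the symbol with upper index 2 and lower
  indices 3, 3.\<close>

lemma ricci_symmetric_walker:
  assumes "open I" "eps \<noteq> 0" "smooth_on I P" "smooth_on I Q" "p \<in> walker_chart I"
  shows "ricci (symmetric_walker_metric eps kap P Q) i j p =
    (if i = 3 \<and> j = 3 then - kap / eps else 0)"
proof -
  let ?\<Gamma> = "christoffel (symmetric_walker_metric eps kap P Q)"
  have PQ: "P field_differentiable at y" "Q field_differentiable at y"
    "deriv P field_differentiable at y" "deriv Q field_differentiable at y" if "y \<in> I" for y
    using assms(3,4) that smooth_on_deriv_iff[OF assms(1)] by metis+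
  have I: "q $ 3 \<in> I" if "q \<in> walker_chart I" for q
    using that by (simp add: walker_chart_def)
  note ch = christoffel_symmetric_walker[OF assms(2) PQ(1,2)[OF I]]
  \<comment> \<open>The closed forms of the symbols hold only on the chart, where \<open>P\<close>
    and \<open>Q\<close> are known to be differentiable; as the chart is open, this determines the
    derivatives at \<open>p\<close>.\<close>
  have p\<Gamma>: "partial l (?\<Gamma> k i j) p = h' (axis l 1)"
    if "(h has_derivative h') (at p)" "\<And>q. q \<in> walker_chart I \<Longrightarrow> ?\<Gamma> k i j q = h q" for h h' l k i j
    using partial_cong_open[OF open_walker_chart[OF assms(1)] assms(5), of h "?\<Gamma> k i j"] that
    by (auto simp: partial_eq differentiable_def)
  have zero: "partial l (?\<Gamma> k i j) p = 0"
    if "\<And>q. q \<in> walker_chart I \<Longrightarrow> ?\<Gamma> k i j q = 0" for l k i j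
    using p\<Gamma>[OF has_derivative_const] that by simp
  \<comment> \<open>With upper index 1 the Ricci trace contains only derivatives in direction 1 or
    of symbols with a lower index 1.\<close>
  have "partial l (?\<Gamma> 1 i j) p = 0" if some_1: "i = 1 \<or> j = 1 \<or> l = 1" for l i j
  proof -
    consider "i = 1 \<or> j = 1 \<or> i = 2 \<and> j = 2" | "l = 1" "i = 3" "j = 3"
      | "l = 1" "i = 2 \<and> j = 3 \<or> i = 3 \<and> j = 2"
      using some_1 exhaust_3[of i] exhaust_3[of j] by auto
    then show ?thesis
    proof cases
      case 1
      then show ?thesis by (intro zero) (auto simp: ch)
    next
      case 2
      have "((\<lambda>q. (q $ 2 * deriv P (q $ 3) + deriv Q (q $ 3)) / 2) has_derivative
        (\<lambda>v. (p $ 2 * (deriv (deriv P) (p $ 3) * v $ 3) + v $ 2 * deriv P (p $ 3)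
          + deriv (deriv Q) (p $ 3) * v $ 3) / 2)) (at p)"
        by (auto intro!: derivative_eq_intros has_derivative_vec_nth has_derivative_coordinate
            PQ[OF I[OF assms(5)]])
      from p\<Gamma>[OF this, of 1 3 3 l] 2 show ?thesis by (simp add: ch axis_components)
    next
      case 3
      have "((\<lambda>q. kap * q $ 2 + P (q $ 3) / 2) has_derivative
        (\<lambda>v. kap * v $ 2 + deriv P (p $ 3) * v $ 3 / 2)) (at p)"
        by (auto intro!: derivative_eq_intros has_derivative_vec_nth has_derivative_coordinate
            PQ[OF I[OF assms(5)]])
      from p\<Gamma>[OF this, of 1 i j l] 3 show ?thesis by (auto simp add: ch axis_components)
    qed
  qed
  moreover have "partial l (?\<Gamma> 2 i j) p = (if i = 3 \<and> j = 3 then - kap / eps else 0)"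
    if "l = 2" for i j l
  proof (cases "i = 3 \<and> j = 3")
    case True
    have "((\<lambda>q. - (2 * kap * q $ 2 + P (q $ 3)) / (2 * eps)) has_derivative
        (\<lambda>v. - (2 * kap * v $ 2 + deriv P (p $ 3) * v $ 3) / (2 * eps))) (at p)"
      by (intro bounded_linear.has_derivative[OF bounded_linear_divide] has_derivative_minus
          has_derivative_add has_derivative_mult_right has_derivative_vec_nth
          has_derivative_coordinate PQ[OF I[OF assms(5)]])
    from p\<Gamma>[OF this, of 2 i j l] True that show ?thesis by (auto simp add: ch axis_components)
  qed (auto intro!: zero simp: ch)
  moreover have "partial l (?\<Gamma> 2 i j) p = 0" if "i \<noteq> 3 \<or> j \<noteq> 3" for i j l
    using that by (intro zero) (auto simp: ch)
  moreover have "partial l (?\<Gamma> 3 i j) p = 0" for i j l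
    by (intro zero) (auto simp: ch)
  ultimately show ?thesis
    using exhaust_3[of i] exhaust_3[of j]
    by (auto simp: ricci_def riemann_def sum_3 ch[OF assms(5,5)])
qed

section \<open>Regularity of solutions of the system\<close>

text \<open>Bootstrapping: the equation expresses \<open>w''\<close> through \<open>w\<close> and smooth data, so each step
  gains a derivative although the system only asks for \<open>w\<close> to be twice differentiable.\<close>

lemma soliton_system_smooth:
  assumes "open I" "eps \<noteq> 0" "smooth_on I P" "smooth_on I Q"
    and sys: "soliton_system I eps kap P Q lam gam w mu"
  shows "smooth_on I w" "smooth_on I mu"
proof -
  note smooth_intros = smooth_on_add[OF assms(1)] smooth_on_diff[OF assms(1)]
    smooth_on_mult[OF assms(1)] smooth_on_const[OF assms(1)]
  have d: "w field_differentiable at y" "deriv w field_differentiable at y"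
      "mu field_differentiable at y"
    and w2: "deriv (deriv w) y =
        (kap / eps) * w y + (1 / (2 * eps)) * (gam * deriv P y - (lam / 2) * P y)"
    and m1: "deriv mu y = (1 / 2) * (kap / eps - P y * w y + lam * Q y - gam * deriv Q y)"
    if "y \<in> I" for y
    using sys that assms(2) unfolding soliton_system_def by (auto simp: field_simps)
  have PQ: "smooth_on I (deriv P)" "smooth_on I (deriv Q)"
    using assms(3,4) smooth_on_deriv_iff[OF assms(1)] by blast+
  have h: "smooth_on I (\<lambda>y. (1 / (2 * eps)) * (gam * deriv P y - (lam / 2) * P y))"
    by (intro smooth_intros PQ assms(3))
  \<comment> \<open>Both orders rise together: \<open>deriv w\<close> of class C^k raises
    \<open>w\<close>, and \<open>w\<close> of class C^k makes \<open>deriv (deriv w)\<close> of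
    class C^k by the equation, which raises \<open>deriv w\<close>.\<close>
  have "Ck_on k I w \<and> Ck_on k I (deriv w)" for k
  proof (induction k)
    case 0
    have "Ck_on 0 I v" if "\<And>y. y \<in> I \<Longrightarrow> v field_differentiable at y" for v :: "real \<Rightarrow> real"
      using that by (auto intro!: continuous_at_imp_continuous_on
          field_differentiable_imp_continuous_at)
    then show ?case using d by blast
  next
    case (Suc k)
    have "Ck_on k I (\<lambda>y. (kap / eps) * w y
        + (1 / (2 * eps)) * (gam * deriv P y - (lam / 2) * P y))"
      using Suc h unfolding smooth_on_def
      by (intro Ck_on_add[OF assms(1)] Ck_on_mult[OF assms(1), of _ "\<lambda>_. kap / eps"]
          Ck_on_const[OF assms(1)]) auto
    then have "Ck_on k I (deriv (deriv w))"
      by (rule Ck_on_cong[OF assms(1), rotated]) (simp add: w2)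
    then show ?case
      using Suc d by (simp add: Ck_on_real_Suc[OF assms(1)] del: Ck_on.simps)
  qed
  then show w: "smooth_on I w" by (simp add: smooth_on_def)
  have "smooth_on I (\<lambda>y. (1 / 2) * (kap / eps - P y * w y + lam * Q y - gam * deriv Q y))"
    by (intro smooth_intros w assms(3,4) PQ)
  then have "smooth_on I (deriv mu)"
    by (rule smooth_on_cong[OF assms(1), rotated]) (simp add: m1)
  then show "smooth_on I mu"
    using d by (simp add: smooth_on_deriv_iff[OF assms(1), of mu])
qed

section \<open>The soliton equation, component by component\<close>

lemma walker_soliton_field_components:
  "walker_soliton_field eps lam gam w mu p $ 1 =
    lam * p $ 1 - eps * p $ 2 * deriv w (p $ 3) + mu (p $ 3)"
  "walker_soliton_field eps lam gam w mu p $ 2 = lam * p $ 2 / 2 + w (p $ 3)"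
  "walker_soliton_field eps lam gam w mu p $ 3 = gam"
  by (simp_all add: walker_soliton_field_def)

lemma soliton_system_imp_ricci_soliton:
  assumes "open I" "eps \<noteq> 0" "smooth_on I P" "smooth_on I Q"
    and sys: "soliton_system I eps kap P Q lam gam w mu"
  shows "ricci_soliton_on (walker_chart I) (symmetric_walker_metric eps kap P Q)
          (walker_soliton_field eps lam gam w mu) lam"
proof -
  let ?g = "symmetric_walker_metric eps kap P Q" and ?X = "walker_soliton_field eps lam gam w mu"
  note U = open_walker_chart[OF assms(1)] and c = smooth_on_chart_functions[OF assms(1)]
  note w\<mu> = soliton_system_smooth[OF assms]
  then have w': "smooth_on I (deriv w)"
    using smooth_on_deriv_iff[OF assms(1)] by blast
  have "smooth_on (walker_chart I) (\<lambda>p. (lam / 2) * p $ 2 + w (p $ 3))"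
    by (intro smooth_on_const[OF U] smooth_on_add[OF U] smooth_on_mult[OF U] c w\<mu>)
  then have "smooth_on (walker_chart I) (\<lambda>p. ?X p $ i)" for i
    using exhaust_3[of i]
    by (auto simp: walker_soliton_field_components
        intro!: smooth_on_const[OF U] smooth_on_add[OF U] smooth_on_diff[OF U]
          smooth_on_mult[OF U] c w\<mu> w')
  moreover have "lie_derivative_metric ?X ?g i j p + ricci ?g i j p = lam * ?g p $ i $ j"
    if p: "p \<in> walker_chart I" for p i j
  proof -
    have y: "p $ 3 \<in> I" using p by (simp add: walker_chart_def)
    have d: "h field_differentiable at (p $ 3)" if "smooth_on I h" for h
      using that y smooth_on_deriv_iff[OF assms(1)] by blast
    have "((\<lambda>q. ?X q $ 1) has_derivative (\<lambda>v. lam * v $ 1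
        - (eps * p $ 2 * (deriv (deriv w) (p $ 3) * v $ 3) + eps * v $ 2 * deriv w (p $ 3))
        + deriv mu (p $ 3) * v $ 3)) (at p)"
      unfolding walker_soliton_field_components
      by (intro has_derivative_add has_derivative_diff has_derivative_mult
          has_derivative_mult_right has_derivative_vec_nth has_derivative_coordinate d w\<mu> w')
    then have X1: "partial i (\<lambda>q. ?X q $ 1) p =
        (if i = 1 then lam else if i = 2 then - eps * deriv w (p $ 3)
         else deriv mu (p $ 3) - eps * p $ 2 * deriv (deriv w) (p $ 3))" for i
      using exhaust_3[of i] by (auto simp: partial_eq axis_components)
    have "((\<lambda>q. ?X q $ 2) has_derivative (\<lambda>v. lam * v $ 2 / 2 + deriv w (p $ 3) * v $ 3)) (at p)"
      unfolding walker_soliton_field_components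
      by (intro has_derivative_add bounded_linear.has_derivative[OF bounded_linear_divide]
          has_derivative_mult_right
          has_derivative_vec_nth has_derivative_coordinate d w\<mu>)
    then have X2: "partial i (\<lambda>q. ?X q $ 2) p =
        (if i = 1 then 0 else if i = 2 then lam / 2 else deriv w (p $ 3))" for i
      using exhaust_3[of i] by (auto simp: partial_eq axis_components)
    have X3: "partial i (\<lambda>q. ?X q $ 3) p = 0" for i
      unfolding walker_soliton_field_components by (simp add: partial_eq[OF has_derivative_const])
    note lie = lie_derivative_metric_def sum_3 X1 X2 X3 partial_symmetric_walker[OF assms(3,4)[THEN d]]
    have eq: "2 * eps * deriv (deriv w) (p $ 3) =
        2 * kap * w (p $ 3) + (gam * deriv P (p $ 3) - lam * P (p $ 3) / 2)"
      "2 * deriv mu (p $ 3) =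
        kap / eps - P (p $ 3) * w (p $ 3) + lam * Q (p $ 3) - gam * deriv Q (p $ 3)"
      using sys y unfolding soliton_system_def by (auto simp: algebra_simps)
    \<comment> \<open>This is twice the \<open>y\<close>-derivative of the
      \<open>t\<close>-component of the field, with both second-order and \<open>mu\<close> terms
      eliminated by the system.\<close>
    have yy: "2 * (deriv mu (p $ 3) - eps * p $ 2 * deriv (deriv w) (p $ 3)) =
        kap / eps - P (p $ 3) * w (p $ 3) + lam * Q (p $ 3) - gam * deriv Q (p $ 3)
        - p $ 2 * (2 * kap * w (p $ 3) + (gam * deriv P (p $ 3) - lam * P (p $ 3) / 2))"
      unfolding eq[symmetric] by (simp add: algebra_simps)
    have "lie_derivative_metric ?X ?g 3 3 p =
        (lam * p $ 2 / 2 + w (p $ 3)) * (2 * kap * p $ 2 + P (p $ 3))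
        + gam * (p $ 2 * deriv P (p $ 3) + deriv Q (p $ 3))
        + 2 * (deriv mu (p $ 3) - eps * p $ 2 * deriv (deriv w) (p $ 3))"
      unfolding lie by (simp add: symmetric_walker_components walker_soliton_field_components)
    \<comment> \<open>The Ricci term cancels \<open>kap / eps\<close>, and the terms in
      \<open>gam\<close>, \<open>P w\<close> and \<open>x w\<close> cancel. The two halves of
      \<open>lam x P\<close> add up, leaving \<open>lam\<close> times
      \<open>kap x^2 + x P + Q\<close>.\<close>
    also have "\<dots> + ricci ?g 3 3 p = lam * ?g p $ 3 $ 3"
      unfolding yy ricci_symmetric_walker[OF assms(1-4) p]
      by (simp add: symmetric_walker_components field_simps power2_eq_square)
    finally have "lie_derivative_metric ?X ?g 3 3 p + ricci ?g 3 3 p = lam * ?g p $ 3 $ 3" .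
    \<comment> \<open>In the \<open>xy\<close> component the term \<open>- eps * deriv w\<close>
      from the \<open>t\<close>-component of the field cancels \<open>eps * deriv w\<close> from its
      \<open>x\<close>-component. The factor 1/2 in the latter gives \<open>lam * eps\<close> for
      \<open>xx\<close>, and \<open>lam * t\<close> gives \<open>lam\<close> for
      \<open>ty\<close>.\<close>
    moreover have "lie_derivative_metric ?X ?g i j p + ricci ?g i j p = lam * ?g p $ i $ j"
      if "i \<noteq> 3 \<or> j \<noteq> 3"
      using that exhaust_3[of i] exhaust_3[of j]
      unfolding lie ricci_symmetric_walker[OF assms(1-4) p]
      by (elim disjE) (simp_all add: symmetric_walker_components walker_soliton_field_components)
    ultimately show ?thesis by blast
  qed
  ultimately show ?thesis
    using pseudo_riemannian_symmetric_walker[OF assms(1-4)] by (simp add: ricci_soliton_on_def)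
qed

section \<open>Existence of solutions on the whole interval\<close>

text \<open>The oriented integral from a fixed base point works on both sides of it. The fundamental
  theorem is applied on compact subintervals.\<close>

lemma antiderivative_on_open_interval:
  fixes h :: "real \<Rightarrow> real"
  assumes "open I" "is_interval I" "continuous_on I h"
  shows "\<exists>F. \<forall>y\<in>I. (F has_real_derivative h y) (at y)"
proof (cases "I = {}")
  case False
  then obtain c where c: "c \<in> I" by blast
  have "((\<lambda>u. LBINT y=c..u. h y) has_real_derivative h x) (at x)" if x: "x \<in> I" for x
  proof -
    have below_above: "\<exists>a\<in>I. \<exists>b\<in>I. a < z \<and> z < b" if z: "z \<in> I" for z
    proof -
      obtain e where "e > 0" "ball z e \<subseteq> I"
        using openE[OF assms(1) z] .
      moreover from this have "z - e / 2 \<in> I" "z + e / 2 \<in> I"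
        by (auto simp: subset_iff dist_real_def)
      ultimately show ?thesis
        by (intro bexI[of _ "z - e / 2"] bexI[of _ "z + e / 2"]) auto
    qed
    have "min c x \<in> I" "max c x \<in> I"
      using c x by (simp_all add: min_def max_def)
    \<comment> \<open>The compact interval must have \<open>x\<close> in its interior, so that the
      derivative within it is the full derivative.\<close>
    then obtain a b where ab: "a \<in> I" "b \<in> I" "a < min c x" "max c x < b"
      using below_above by metis
    have "{a..b} \<subseteq> I"
      using ab(1,2) assms(2) unfolding is_interval_1 by (meson atLeastAtMost_iff subsetI)
    then have "((\<lambda>u. LBINT y=c..u. h y) has_vector_derivative h x) (at x within {a..b})"
      using ab assms(3) by (intro interval_integral_FTC2) (auto intro: continuous_on_subset)
    moreover have "at x within {a..b} = at x"
      using ab by (intro at_within_interior) auto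
    ultimately show ?thesis by (simp add: has_real_derivative_iff_has_vector_derivative)
  qed
  then show ?thesis by blast
qed simp

text \<open>Two solutions of \<open>u'' = c u\<close>, by the sign of \<open>c\<close>: 1 and
  \<open>y\<close>, hyperbolic, or trigonometric. Dividing the odd solution by \<open>s\<close>
  normalizes the Wronskian to 1.\<close>

lemma fundamental_system_exists:
  fixes c :: real
  obtains u u' v v' where "\<And>y. (u has_real_derivative u' y) (at y)"
    "\<And>y. (u' has_real_derivative c * u y) (at y)"
    "\<And>y. (v has_real_derivative v' y) (at y)"
    "\<And>y. (v' has_real_derivative c * v y) (at y)"
    "\<And>y. u y * v' y - u' y * v y = 1"
proof -
  consider "c = 0" | s where "s \<noteq> 0" "c = s\<^sup>2" | s where "s \<noteq> 0" "c = - s\<^sup>2"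
  proof (cases c "0::real" rule: linorder_cases)
    case less
    then show ?thesis using that(3)[of "sqrt (- c)"] by auto
  next
    case greater
    then show ?thesis using that(2)[of "sqrt c"] by auto
  qed (use that in auto)
  then show thesis
  proof cases
    case 1
    show thesis
      by (rule that[of "\<lambda>y. 1" "\<lambda>y. 0" "\<lambda>y. y" "\<lambda>y. 1"])
        (auto simp: 1 intro!: derivative_eq_intros)
  next
    case (2 s)
    have "cosh (s * y) * cosh (s * y) - sinh (s * y) * sinh (s * y) = 1" for y
      using cosh_square_eq[of "s * y"] by (simp add: power2_eq_square)
    then show thesis using 2
      by (intro that[of "\<lambda>y. cosh (s * y)" "\<lambda>y. s * sinh (s * y)"
          "\<lambda>y. sinh (s * y) / s" "\<lambda>y. cosh (s * y)"])
        (auto simp: power2_eq_square intro!: derivative_eq_intros)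
  next
    case (3 s)
    have "cos (s * y) * cos (s * y) + sin (s * y) * sin (s * y) = 1" for y
      using sin_cos_squared_add[of "s * y"] by (simp add: power2_eq_square)
    then show thesis using 3
      by (intro that[of "\<lambda>y. cos (s * y)" "\<lambda>y. - s * sin (s * y)"
          "\<lambda>y. sin (s * y) / s" "\<lambda>y. cos (s * y)"])
        (auto simp: power2_eq_square intro!: derivative_eq_intros)
  qed
qed

text \<open>Variation of parameters: \<open>w = v \<integral> u h - u \<integral> v h\<close> with \<open>u, v\<close> of Wronskian 1.\<close>

lemma second_order_linear_solution_exists:
  fixes c :: real and h :: "real \<Rightarrow> real"
  assumes "open I" "is_interval I" "continuous_on I h"
  shows "\<exists>w w'. \<forall>y\<in>I. (w has_real_derivative w' y) (at y) \<and>
    (w' has_real_derivative c * w y + h y) (at y)"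
proof -
  obtain u u' v v' where
    du: "\<And>y. (u has_real_derivative u' y) (at y)" "\<And>y. (u' has_real_derivative c * u y) (at y)"
    and dv: "\<And>y. (v has_real_derivative v' y) (at y)" "\<And>y. (v' has_real_derivative c * v y) (at y)"
    and wronskian: "\<And>y. u y * v' y - u' y * v y = 1"
    by (rule fundamental_system_exists[of c]) blast
  have "continuous_on I u" "continuous_on I v"
    using DERIV_isCont[OF du(1)] DERIV_isCont[OF dv(1)]
    by (simp_all add: continuous_at_imp_continuous_on)
  note antiderivative_on_open_interval[OF assms(1,2) continuous_on_mult[OF this(1) assms(3)]]
    antiderivative_on_open_interval[OF assms(1,2) continuous_on_mult[OF this(2) assms(3)]]
  then obtain A B where
    A: "\<And>y. y \<in> I \<Longrightarrow> (A has_real_derivative u y * h y) (at y)" and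
    B: "\<And>y. y \<in> I \<Longrightarrow> (B has_real_derivative v y * h y) (at y)"
    by blast
  \<comment> \<open>In the first derivative the contributions \<open>v u h\<close> and
    \<open>u v h\<close> of \<open>A\<close> and \<open>B\<close> cancel; in the second they combine
    to the Wronskian times \<open>h\<close>.\<close>
  have "((\<lambda>y. v y * A y - u y * B y) has_real_derivative v' y * A y - u' y * B y) (at y) \<and>
    ((\<lambda>y. v' y * A y - u' y * B y) has_real_derivative c * (v y * A y - u y * B y) + h y) (at y)"
    if y: "y \<in> I" for y
  proof
    show "((\<lambda>y. v y * A y - u y * B y) has_real_derivative v' y * A y - u' y * B y) (at y)"
      by (rule DERIV_cong[OF DERIV_diff[OF DERIV_mult[OF dv(1) A[OF y]] DERIV_mult[OF du(1) B[OF y]]]])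
        (simp add: algebra_simps)
    have "c * v y * A y + u y * h y * v' y - (c * u y * B y + v y * h y * u' y) =
        c * (v y * A y - u y * B y) + (u y * v' y - u' y * v y) * h y"
      by (simp add: algebra_simps)
    then show "((\<lambda>y. v' y * A y - u' y * B y) has_real_derivative
        c * (v y * A y - u y * B y) + h y) (at y)"
      unfolding wronskian
      by (intro DERIV_cong[OF DERIV_diff[OF DERIV_mult[OF dv(2) A[OF y]] DERIV_mult[OF du(2) B[OF y]]]])
        linarith
  qed
  then show ?thesis
    by (intro exI[of _ "\<lambda>y. v y * A y - u y * B y"]
        exI[of _ "\<lambda>y. v' y * A y - u' y * B y"] ballI)
qed

text \<open>The first equation does not involve \<open>mu\<close>. Dividing it by
  \<open>2 * eps\<close> gives \<open>w'' = (kap / eps) w + h\<close> with continuous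
  \<open>h\<close>; then \<open>mu\<close> has a known continuous derivative.\<close>

lemma soliton_system_exists:
  assumes "open I" "is_interval I" "eps \<noteq> 0" "smooth_on I P" "smooth_on I Q"
  shows "\<exists>w mu. soliton_system I eps kap P Q lam gam w mu"
proof -
  have cont: "continuous_on I h" if "smooth_on I h" for h :: "real \<Rightarrow> real"
    using that[unfolded smooth_on_def, rule_format, of 0] by simp
  have "smooth_on I (deriv P)" "smooth_on I (deriv Q)"
    using assms(4,5) smooth_on_deriv_iff[OF assms(1)] by blast+
  note c = this[THEN cont] assms(4,5)[THEN cont]
  have "continuous_on I (\<lambda>y. (gam * deriv P y - lam * P y / 2) / (2 * eps))"
    using assms(3) by (intro continuous_intros c) auto
  then obtain w w' where
    w: "\<And>y. y \<in> I \<Longrightarrow> (w has_real_derivative w' y) (at y)" and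
    w': "\<And>y. y \<in> I \<Longrightarrow> (w' has_real_derivative
        kap / eps * w y + (gam * deriv P y - lam * P y / 2) / (2 * eps)) (at y)"
    using second_order_linear_solution_exists[OF assms(1,2), of _ "kap / eps"] by blast
  have "continuous_on I w"
    using DERIV_isCont[OF w] by (simp add: continuous_at_imp_continuous_on)
  then have "continuous_on I (\<lambda>y. (kap / eps - P y * w y + lam * Q y - gam * deriv Q y) / 2)"
    by (intro continuous_intros c) auto
  then obtain mu where mu: "\<And>y. y \<in> I \<Longrightarrow> (mu has_real_derivative
      (kap / eps - P y * w y + lam * Q y - gam * deriv Q y) / 2) (at y)"
    using antiderivative_on_open_interval[OF assms(1,2)] by blast
  \<comment> \<open>\<open>deriv w\<close> is known to agree with \<open>w'\<close> only on
    \<open>I\<close>; openness of \<open>I\<close> suffices to transfer the derivative.\<close>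
  have "(deriv w has_real_derivative
      kap / eps * w y + (gam * deriv P y - lam * P y / 2) / (2 * eps)) (at y)" if "y \<in> I" for y
    by (rule has_field_derivative_transform_within_open[OF w' assms(1)])
      (use that DERIV_imp_deriv[OF w] in auto)
  then have dd: "deriv w field_differentiable at y"
    "deriv (deriv w) y = kap / eps * w y + (gam * deriv P y - lam * P y / 2) / (2 * eps)"
    if "y \<in> I" for y
    using that by (auto simp: field_differentiable_def DERIV_imp_deriv)
  have "w field_differentiable at y" "mu field_differentiable at y"
    "2 * deriv mu y = kap / eps - P y * w y + lam * Q y - gam * deriv Q y" if "y \<in> I" for y
    using w[OF that] mu[OF that] by (auto simp: field_differentiable_def DERIV_imp_deriv)
  moreover have "2 * eps * deriv (deriv w) y - 2 * kap * w y = gam * deriv P y - lam * P y / 2"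
    if "y \<in> I" for y
    unfolding dd(2)[OF that] using assms(3) by (simp add: distrib_left)
  ultimately show ?thesis
    unfolding soliton_system_def using dd(1) by blast
qed

section \<open>Variation of the causal character along a \<open>t\<close>-line\<close>

lemma causal_character_varies:
  assumes "I \<noteq> {}" "lam * gam \<noteq> 0"
  shows "\<exists>p\<in>walker_chart I. \<exists>q\<in>walker_chart I.
    causal_character_at (walker_metric eps f) (walker_soliton_field eps lam gam w mu) p \<noteq>
    causal_character_at (walker_metric eps f) (walker_soliton_field eps lam gam w mu) q"
proof -
  obtain y where y: "y \<in> I" using assms(1) by blast
  let ?p = "\<lambda>t. vector [t, 0, y] :: real^3" and ?X = "walker_soliton_field eps lam gam w mu"
  \<comment> \<open>The value of \<open>g(X, X)\<close> at \<open>t = 0\<close>; setting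
    \<open>x = 0\<close> removes the term with \<open>deriv w\<close>.\<close>
  define b where "b = 2 * gam * mu y + eps * (w y)\<^sup>2 + gam\<^sup>2 * f 0 y"
  have norm: "?X (?p t) \<bullet> (walker_metric eps f (?p t) *v ?X (?p t)) = 2 * (lam * gam) * t + b" for t
    by (simp add: b_def inner_vec_def matrix_vector_mult_def sum_3 walker_metric_components
        walker_soliton_field_components algebra_simps power2_eq_square)
  \<comment> \<open>The two values of \<open>t\<close> solve
    \<open>2 * (lam * gam) * t + b = 1\<close> and \<open>= 0\<close>.\<close>
  have "causal_character_at (walker_metric eps f) ?X (?p ((1 - b) / (2 * (lam * gam)))) = Spacelike"
    "causal_character_at (walker_metric eps f) ?X (?p ((0 - b) / (2 * (lam * gam)))) = Null"
    using assms(2) unfolding causal_character_at_def norm by simp_all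
  moreover have "?p t \<in> walker_chart I" for t
    using y by (simp add: walker_chart_def)
  ultimately show ?thesis by (metis causal_character.distinct(3))
qed

theorem theorem9:
  fixes eps kap :: real and P Q :: "real \<Rightarrow> real" and I :: "real set"
  assumes "eps = 1 \<or> eps = -1"
    and "open I" and "is_interval I" and "I \<noteq> {}"
    and "smooth_on I P" and "smooth_on I Q"
  shows
    "(\<forall>lam gam. \<exists>w mu. soliton_system I eps kap P Q lam gam w mu) \<and>
     (\<forall>lam gam w mu. soliton_system I eps kap P Q lam gam w mu \<longrightarrow>
        ricci_soliton_on (walker_chart I) (symmetric_walker_metric eps kap P Q)
          (walker_soliton_field eps lam gam w mu) lam) \<and>
     (\<exists>X. expanding_soliton_on (walker_chart I) (symmetric_walker_metric eps kap P Q) X) \<and>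
     (\<exists>X. steady_soliton_on (walker_chart I) (symmetric_walker_metric eps kap P Q) X) \<and>
     (\<exists>X. shrinking_soliton_on (walker_chart I) (symmetric_walker_metric eps kap P Q) X) \<and>
     (\<exists>lam gam w mu. soliton_system I eps kap P Q lam gam w mu \<and>
        (\<exists>p\<in>walker_chart I. \<exists>q\<in>walker_chart I.
           causal_character_at (symmetric_walker_metric eps kap P Q)
             (walker_soliton_field eps lam gam w mu) p \<noteq>
           causal_character_at (symmetric_walker_metric eps kap P Q)
             (walker_soliton_field eps lam gam w mu) q))"
proof -
  have eps: "eps \<noteq> 0" using assms(1) by auto
  have ex: "\<exists>w mu. soliton_system I eps kap P Q lam gam w mu" for lam gam
    by (rule soliton_system_exists[OF assms(2,3) eps assms(5,6)])
  have sol: "ricci_soliton_on (walker_chart I) (symmetric_walker_metric eps kap P Q)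
      (walker_soliton_field eps lam gam w mu) lam"
    if "soliton_system I eps kap P Q lam gam w mu" for lam gam w mu
    by (rule soliton_system_imp_ricci_soliton[OF assms(2) eps assms(5,6) that])
  \<comment> \<open>Every real \<open>lam\<close> occurs, so -1, 0 and 1 provide the expanding,
    steady and shrinking cases.\<close>
  have "\<exists>X. ricci_soliton_on (walker_chart I) (symmetric_walker_metric eps kap P Q) X lam" for lam
    using ex sol by blast
  moreover have "(-1::real) < 0" "(1::real) > 0" by simp_all
  \<comment> \<open>With \<open>lam = gam = 1\<close> the slope in \<open>t\<close> is nonzero
    whatever \<open>w\<close> and \<open>mu\<close> are, so any solution of the system serves as
    witness.\<close>
  moreover have "\<exists>p\<in>walker_chart I. \<exists>q\<in>walker_chart I.
      causal_character_at (symmetric_walker_metric eps kap P Q)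
        (walker_soliton_field eps 1 1 w mu) p \<noteq>
      causal_character_at (symmetric_walker_metric eps kap P Q)
        (walker_soliton_field eps 1 1 w mu) q" for w mu
    unfolding symmetric_walker_metric_def
    by (rule causal_character_varies[OF assms(4)]) simp
  ultimately show ?thesis
    unfolding expanding_soliton_on_def steady_soliton_on_def shrinking_soliton_on_def
    using ex sol by meson
qed

end
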